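(* For any $n \geq 2$ and any sequence of random variables $X_1, X_2, \ldots, X_n, \ldots$, it is true that $$E\left[X_{n+1} - E(X_{n+1} \mid X_{i_1}, X_{i_2}, \ldots, X_{i_l})\right]^2 \leq E\left[X_{n+1} - E(X_{n+1} \mid X_{i_1}, X_{i_2}, \ldots, X_{i_k})\right]^2$$ for all $1 \leq k < l \leq n$ and all indices $1 \leq i_1 < i_2 < \cdots < i_k < \cdots < i_l \leq n$. For example (whenever the index ranges make sense), $$E\left[X_{n+1} - E(X_{n+1} \mid X_1, \ldots, X_n)\right]^2 \leq E\left[X_{n+1} - E(X_{n+1} \mid X_1, \ldots, X_{n-1})\right]^2,$$ $$E\left[X_{n+1} - E(X_{n+1} \mid X_1, \ldots, X_n)\right]^2 \leq E\left[X_{n+1} - E(X_{n+1} \mid X_1, \ldots, X_{n-2})\right]^2 \quad (n\ge 3),$$ $$E\left[X_{n+1} - E(X_{n+1} \mid X_1, \ldots, X_n)\right]^2 \leq E\left[X_{n+1} - E(X_{n+1} \mid X_2, X_3, \ldots, X_n)\right]^2,$$ $$E\left[X_{n+1} - E(X_{n+1} \mid X_2, X_3, X_4)\right]^2 \leq E\left[X_{n+1} - E(X_{n+1} \mid X_2, X_3)\right]^2 \quad (n\ge 4).$$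
   Context: All random variables are defined on a common probability space $(\Omega, \mathcal{F}, P)$. $E(X_{n+1} \mid X_{i_1}, \ldots, X_{i_k})$ denotes the conditional expectation of $X_{n+1}$ given the sigma-algebra generated by $X_{i_1}, \ldots, X_{i_k}$. The notation $E[\cdot]^2$ means the expectation of the square. *)

theory Defs
  imports "HOL-Probability.Probability"
begin

definition generated_algebra :: "'a measure \<Rightarrow> ('i \<Rightarrow> 'a \<Rightarrow> real) \<Rightarrow> 'i set \<Rightarrow> 'a measure" where
  "generated_algebra M X J =
     sigma (space M) (\<Union>j\<in>J. {X j -` A \<inter> space M | A. A \<in> sets borel})"

(* For integrable Y this is a version of E(Y | X_j, j in J).  Without integrability, real_cond_exp
   is E(Y^+ | ..) - E(Y^- | ..), where the value infinity of either term is replaced by 0. *)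
definition cond_exp_given ::
    "'a measure \<Rightarrow> ('i \<Rightarrow> 'a \<Rightarrow> real) \<Rightarrow> ('a \<Rightarrow> real) \<Rightarrow> 'i set \<Rightarrow> 'a \<Rightarrow> real" where
  "cond_exp_given M X Y J = real_cond_exp M (generated_algebra M X J) Y"

(* The expectation of the square is taken in [0, \<infinity>]: no second moment is assumed, and the
   Bochner integral of a square that is not integrable would be 0. *)
definition mean_square_error ::
    "'a measure \<Rightarrow> ('i \<Rightarrow> 'a \<Rightarrow> real) \<Rightarrow> ('a \<Rightarrow> real) \<Rightarrow> 'i set \<Rightarrow> ennreal" where
  "mean_square_error M X Y J =
     (\<integral>\<^sup>+ \<omega>. ennreal ((Y \<omega> - cond_exp_given M X Y J \<omega>)\<^sup>2) \<partial>M)"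

end

theory Submission
  imports Defs
begin

text \<open>The conditional expectation given a sigma-algebra \<open>F\<close> is the best mean square approximation
  among all \<open>F\<close>-measurable functions \<open>Z\<close>, and a conditional expectation given fewer variables is
  measurable with respect to the larger sigma-algebra. If \<open>Y - Z\<close> is square integrable, then
  \<open>E(Y | F) = Z + E(Y - Z | F)\<close> even for non-integrable \<open>Y\<close>, because both sides agree on each of
  the sets \<open>{\<bar>Z\<bar> \<le> m}\<close> of \<open>F\<close>, where \<open>Y\<close> is integrable. Hence
  \<open>Y - E(Y | F)\<close> is \<open>Y - Z\<close> minus its conditional expectation, and subtracting the conditional
  expectation does not increase the second moment.\<close>

text \<open>Localises \<open>real_cond_exp\<close> to a set of \<open>F\<close> without
  integrability of \<open>f\<close>: the indicator is pulled out of the nonnegative conditional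
  expectations of the positive and negative parts separately, which needs only
  measurability.\<close>

lemma (in sigma_finite_subalgebra) real_cond_exp_indicator_mult:
  assumes A: "A \<in> sets F" and [measurable]: "f \<in> borel_measurable M"
  shows "AE x in M. x \<in> A \<longrightarrow>
    real_cond_exp M F (\<lambda>x. indicator A x * f x) x = real_cond_exp M F f x"
proof -
  have *: "AE x in M. x \<in> A \<longrightarrow>
      nn_cond_exp M F (\<lambda>x. ennreal (indicator A x * g x)) x = nn_cond_exp M F (\<lambda>x. ennreal (g x)) x"
    if [measurable]: "g \<in> borel_measurable M" for g :: "'a \<Rightarrow> real"
  proof -
    have "AE x in M. indicator A x * nn_cond_exp M F (\<lambda>x. ennreal (g x)) x
        = nn_cond_exp M F (\<lambda>x. indicator A x * ennreal (g x)) x"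
      by (rule nn_cond_exp_prod) (use A in auto)
    moreover have "(\<lambda>x. ennreal (indicator A x * g x)) = (\<lambda>x. indicator A x * ennreal (g x))"
      by (auto simp: fun_eq_iff indicator_def)
    ultimately show ?thesis
      by (auto elim!: eventually_mono)
  qed
  show ?thesis
    \<comment> \<open>\<open>ennreal\<close> sends negative reals to 0, so \<open>f\<close> and
      \<open>- f\<close> yield the positive and the negative part of \<open>f\<close>, the two terms
      in the definition of \<open>real_cond_exp\<close>.\<close>
    using *[of f] *[of "\<lambda>x. - f x"] unfolding real_cond_exp_def by auto
qed

lemma (in finite_measure_subalgebra) real_cond_exp_add_F_meas:
  assumes Z: "Z \<in> borel_measurable F" and W: "integrable M W"
  shows "AE x in M. real_cond_exp M F (\<lambda>x. Z x + W x) x = Z x + real_cond_exp M F W x"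
proof -
  have [measurable]: "Z \<in> borel_measurable M"
    by (rule measurable_from_subalg[OF subalg Z])
  have [measurable]: "W \<in> borel_measurable M"
    using W by auto
  define B where "B m = {x \<in> space F. \<bar>Z x\<bar> \<le> real m}" for m :: nat
  have BF: "B m \<in> sets F" for m
    unfolding B_def using Z by measurable
  have BM [measurable]: "B m \<in> sets M" for m
    using BF subalg by (auto simp: subalgebra_def)
  have "AE x in M. x \<in> B m \<longrightarrow> real_cond_exp M F (\<lambda>x. Z x + W x) x = Z x + real_cond_exp M F W x" for m
  proof -
    \<comment> \<open>The truncation makes \<open>Z\<close> bounded, and the measure is finite; so
      additivity of \<open>real_cond_exp\<close> for integrable functions applies on
      \<open>B m\<close>.\<close>
    have IZ: "integrable M (\<lambda>x. indicator (B m) x * Z x)"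
    proof (rule integrable_const_bound[of _ "real m"])
      show "AE x in M. norm (indicator (B m) x * Z x) \<le> real m"
        by (auto simp: B_def indicator_def)
    qed measurable
    have IW: "integrable M (\<lambda>x. indicator (B m) x * W x)"
      using integrable_mult_indicator[OF BM W] by simp
    have 1: "AE x in M. real_cond_exp M F (\<lambda>x. indicator (B m) x * Z x + indicator (B m) x * W x) x
       = real_cond_exp M F (\<lambda>x. indicator (B m) x * Z x) x + real_cond_exp M F (\<lambda>x. indicator (B m) x * W x) x"
      by (rule real_cond_exp_add[OF IZ IW])
    have 2: "AE x in M. real_cond_exp M F (\<lambda>x. indicator (B m) x * Z x) x = indicator (B m) x * Z x"
      by (rule real_cond_exp_F_meas[OF IZ]) (use Z BF in auto)
    have 3: "AE x in M. x \<in> B m \<longrightarrow>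
        real_cond_exp M F (\<lambda>x. indicator (B m) x * W x) x = real_cond_exp M F W x"
      by (rule real_cond_exp_indicator_mult[OF BF]) simp
    have "AE x in M. x \<in> B m \<longrightarrow>
        real_cond_exp M F (\<lambda>x. indicator (B m) x * (Z x + W x)) x = real_cond_exp M F (\<lambda>x. Z x + W x) x"
      by (rule real_cond_exp_indicator_mult[OF BF]) simp
    with 1 2 3 show ?thesis
      by (auto simp: distrib_left)
  qed
  \<comment> \<open>The countably many exceptional null sets are merged into one; the sets
    \<open>B m\<close> cover the space because \<open>Z\<close> is real-valued.\<close>
  then have "AE x in M. \<forall>m. x \<in> B m \<longrightarrow>
      real_cond_exp M F (\<lambda>x. Z x + W x) x = Z x + real_cond_exp M F W x"
    by (subst AE_all_countable) blast
  moreover have "\<exists>m. x \<in> B m" if "x \<in> space M" for x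
    using that subalg real_arch_simple[of "\<bar>Z x\<bar>"] by (auto simp: B_def subalgebra_def)
  ultimately show ?thesis
    using AE_space by (auto elim!: eventually_elim2)
qed

text \<open>Pythagoras: for V = E(W | F) one has E(V W) = E(V^2), so E(W - V)^2 = E(W^2) -
  E(V^2).\<close>

lemma (in finite_measure_subalgebra) integral_diff_cond_exp_squared_le:
  assumes W: "integrable M W" and W2: "integrable M (\<lambda>x. (W x)\<^sup>2)"
  shows "integrable M (\<lambda>x. (W x - real_cond_exp M F W x)\<^sup>2)"
    and "(\<integral>x. (W x - real_cond_exp M F W x)\<^sup>2 \<partial>M) \<le> (\<integral>x. (W x)\<^sup>2 \<partial>M)"
proof -
  define V where "V = real_cond_exp M F W"
  have [measurable]: "W \<in> borel_measurable M" "V \<in> borel_measurable M"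
    using W by (auto simp: V_def)
  \<comment> \<open>Conditional Jensen inequality for the convex function v^2.\<close>
  have V2: "integrable M (\<lambda>x. (V x)\<^sup>2)"
    unfolding V_def
    by (rule integrable_convex_cond_exp[OF W, of UNIV])
       (use W2 in \<open>auto intro: convex_power2\<close>)
  have VW: "integrable M (\<lambda>x. V x * W x)"
  proof (rule Bochner_Integration.integrable_bound[OF Bochner_Integration.integrable_add[OF V2 W2]])
    have "\<bar>v * w\<bar> \<le> v\<^sup>2 + w\<^sup>2" for v w :: real
    proof -
      have "2 * \<bar>v * w\<bar> \<le> v\<^sup>2 + w\<^sup>2"
        using sum_squares_bound[of "\<bar>v\<bar>" "\<bar>w\<bar>"] by (simp add: abs_mult mult.assoc)
      then show ?thesis
        by linarith
    qed
    then show "AE x in M. norm (V x * W x) \<le> norm ((V x)\<^sup>2 + (W x)\<^sup>2)"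
      by simp
  qed simp
  \<comment> \<open>The defining property of the conditional expectation of \<open>W\<close>, tested
    against the \<open>F\<close>-measurable function \<open>V\<close> itself.\<close>
  have "(\<integral>x. V x * V x \<partial>M) = (\<integral>x. V x * W x \<partial>M)"
    using real_cond_exp_intg(2)[OF VW] by (simp add: V_def)
  then have E: "(\<integral>x. V x * W x \<partial>M) = (\<integral>x. (V x)\<^sup>2 \<partial>M)"
    by (simp add: power2_eq_square)
  have eq: "(W x - V x)\<^sup>2 = (W x)\<^sup>2 - 2 * (V x * W x) + (V x)\<^sup>2" for x
    by (simp add: power2_eq_square algebra_simps)
  show "integrable M (\<lambda>x. (W x - real_cond_exp M F W x)\<^sup>2)"
    unfolding V_def[symmetric] eq using V2 W2 VW by auto
  have "(\<integral>x. (W x - V x)\<^sup>2 \<partial>M) = (\<integral>x. (W x)\<^sup>2 \<partial>M) - (\<integral>x. (V x)\<^sup>2 \<partial>M)"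
    unfolding eq using V2 W2 VW by (simp add: E)
  then show "(\<integral>x. (W x - real_cond_exp M F W x)\<^sup>2 \<partial>M) \<le> (\<integral>x. (W x)\<^sup>2 \<partial>M)"
    unfolding V_def[symmetric] by simp
qed

lemma (in finite_measure_subalgebra) nn_integral_diff_cond_exp_squared_le:
  assumes Z: "Z \<in> borel_measurable F" and [measurable]: "Y \<in> borel_measurable M"
  shows "(\<integral>\<^sup>+x. ennreal ((Y x - real_cond_exp M F Y x)\<^sup>2) \<partial>M) \<le> (\<integral>\<^sup>+x. ennreal ((Y x - Z x)\<^sup>2) \<partial>M)"
\<comment> \<open>An infinite right-hand side leaves nothing to prove. Otherwise
  \<open>Y - Z\<close> is square integrable, hence integrable since the measure is finite, although
  \<open>Y\<close> and \<open>Z\<close> separately may not be.\<close>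
proof (cases "(\<integral>\<^sup>+x. ennreal ((Y x - Z x)\<^sup>2) \<partial>M) = \<infinity>")
  case False
  define W where "W x = Y x - Z x" for x
  have [measurable]: "Z \<in> borel_measurable M"
    by (rule measurable_from_subalg[OF subalg Z])
  have [measurable]: "W \<in> borel_measurable M"
    unfolding W_def by measurable
  have W2: "integrable M (\<lambda>x. (W x)\<^sup>2)"
    by (rule integrableI_nonneg) (use False in \<open>auto simp: W_def top.not_eq_extremum\<close>)
  have W: "integrable M W"
    by (rule square_integrable_imp_integrable[OF _ W2]) simp
  have "AE x in M. real_cond_exp M F Y x = Z x + real_cond_exp M F W x"
    using real_cond_exp_add_F_meas[OF Z W] by (simp add: W_def)
  then have "(\<integral>\<^sup>+x. ennreal ((Y x - real_cond_exp M F Y x)\<^sup>2) \<partial>M)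
      = (\<integral>\<^sup>+x. ennreal ((W x - real_cond_exp M F W x)\<^sup>2) \<partial>M)"
    by (intro nn_integral_cong_AE) (auto simp: W_def diff_diff_eq elim!: eventually_mono)
  also have "\<dots> = ennreal (\<integral>x. (W x - real_cond_exp M F W x)\<^sup>2 \<partial>M)"
    by (rule nn_integral_eq_integral) (simp_all add: integral_diff_cond_exp_squared_le(1)[OF W W2])
  also have "\<dots> \<le> ennreal (\<integral>x. (W x)\<^sup>2 \<partial>M)"
    by (rule ennreal_leI) (rule integral_diff_cond_exp_squared_le(2)[OF W W2])
  also have "\<dots> = (\<integral>\<^sup>+x. ennreal ((W x)\<^sup>2) \<partial>M)"
    by (rule nn_integral_eq_integral[symmetric]) (simp_all add: W2)
  finally show ?thesis
    by (simp add: W_def)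
qed simp

lemma space_generated_algebra [simp]: "space (generated_algebra M X J) = space M"
  by (auto simp: generated_algebra_def space_measure_of_conv)

lemma sets_generated_algebra:
  "sets (generated_algebra M X J)
    = sigma_sets (space M) (\<Union>j\<in>J. {X j -` A \<inter> space M | A. A \<in> sets borel})"
  unfolding generated_algebra_def by (rule sets_measure_of) auto

lemma sets_generated_algebra_mono:
  "J \<subseteq> K \<Longrightarrow> sets (generated_algebra M X J) \<subseteq> sets (generated_algebra M X K)"
  unfolding sets_generated_algebra by (rule sigma_sets_mono') blast

lemma subalgebra_generated_algebra:
  assumes "\<And>j. j \<in> J \<Longrightarrow> X j \<in> borel_measurable M"
  shows "subalgebra M (generated_algebra M X J)"
proof -
  have "sets (generated_algebra M X J) \<subseteq> sets M"
    unfolding sets_generated_algebra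
    by (rule sets.sigma_sets_subset) (use assms in \<open>auto intro: measurable_sets\<close>)
  then show ?thesis
    by (simp add: subalgebra_def)
qed

lemma mean_square_error_antimono:
  assumes "finite_measure M" and Y: "Y \<in> borel_measurable M"
    and X: "\<And>j. j \<in> K \<Longrightarrow> X j \<in> borel_measurable M" and "J \<subseteq> K"
  shows "mean_square_error M X Y K \<le> mean_square_error M X Y J"
proof -
  interpret finite_measure_subalgebra M "generated_algebra M X K"
    using assms(1) subalgebra_generated_algebra[of K X M] X
    by (simp add: finite_measure_subalgebra_def finite_measure_subalgebra_axioms_def)
  have "subalgebra (generated_algebra M X K) (generated_algebra M X J)"
    using sets_generated_algebra_mono[OF \<open>J \<subseteq> K\<close>] by (simp add: subalgebra_def)
  \<comment> \<open>The conditional expectation given the smaller family thus serves as the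
    competitor \<open>Z\<close> in the best approximation property for \<open>K\<close>.\<close>
  then have "cond_exp_given M X Y J \<in> borel_measurable (generated_algebra M X K)"
    unfolding cond_exp_given_def
    by (rule measurable_from_subalg) (rule borel_measurable_cond_exp)
  from nn_integral_diff_cond_exp_squared_le[OF this Y] show ?thesis
    by (simp add: mean_square_error_def cond_exp_given_def)
qed

theorem corollary1:
  fixes M :: "'a measure" and X :: "nat \<Rightarrow> 'a \<Rightarrow> real" and n :: nat
  assumes "prob_space M"
    and "\<And>m. 1 \<le> m \<Longrightarrow> X m \<in> borel_measurable M"
    and "2 \<le> n"
  shows "(\<forall>k l. \<forall>i :: nat \<Rightarrow> nat.
            1 \<le> k \<and> k < l \<and> l \<le> n \<and> strict_mono_on {1..l} i \<and> i ` {1..l} \<subseteq> {1..n} \<longrightarrow>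
            mean_square_error M X (X (n + 1)) (i ` {1..l})
              \<le> mean_square_error M X (X (n + 1)) (i ` {1..k}))
       \<and> mean_square_error M X (X (n + 1)) {1..n}
           \<le> mean_square_error M X (X (n + 1)) {1..n - 1}
       \<and> (3 \<le> n \<longrightarrow> mean_square_error M X (X (n + 1)) {1..n}
           \<le> mean_square_error M X (X (n + 1)) {1..n - 2})
       \<and> mean_square_error M X (X (n + 1)) {1..n}
           \<le> mean_square_error M X (X (n + 1)) {2..n}
       \<and> (4 \<le> n \<longrightarrow> mean_square_error M X (X (n + 1)) {2, 3, 4}
           \<le> mean_square_error M X (X (n + 1)) {2, 3})"
proof -
  interpret prob_space M by fact
  \<comment> \<open>Every claim of the theorem is an inclusion of index sets. The bound
    \<open>K \<subseteq> {1..}\<close> keeps out \<open>X 0\<close>, about which nothing is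
    assumed.\<close>
  have *: "mean_square_error M X (X (n + 1)) K \<le> mean_square_error M X (X (n + 1)) J"
    if "J \<subseteq> K" "K \<subseteq> {1..}" for J K
    by (rule mean_square_error_antimono) (use that assms(2) finite_measure_axioms in auto)
  show ?thesis
  proof (intro conjI allI impI)
    fix k l and i :: "nat \<Rightarrow> nat"
    assume "1 \<le> k \<and> k < l \<and> l \<le> n \<and> strict_mono_on {1..l} i \<and> i ` {1..l} \<subseteq> {1..n}"
    then have "i ` {1..k} \<subseteq> i ` {1..l}" "i ` {1..l} \<subseteq> {1..}"
      by (auto intro!: image_mono)
    then show "mean_square_error M X (X (n + 1)) (i ` {1..l})
        \<le> mean_square_error M X (X (n + 1)) (i ` {1..k})"
      by (rule *)
  qed (rule *; auto)+
qed

end
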